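(* Given two third-order tensors $\mathscr{T}\in\mathbb{R}^{n_1\times l\times n_3}$ and $\mathscr{S}\in\mathbb{R}^{l\times n_2\times n_3}$ in the TTD format with core tensors $\mathscr{G}_1,\mathscr{G}_2,\mathscr{G}_3$ and $\mathscr{H}_1,\mathscr{H}_2,\mathscr{H}_3$, and TT-ranks $\{1,r_1,r_2,1\}$ and $\{1,s_1,s_2,1\}$, respectively, their T-product $\mathscr{T}\star\mathscr{S}\in\mathbb{R}^{n_1\times n_2\times n_3}$ admits a TTD representation with core tensors $$\mathscr{P}_1(1,j_1,\phi(\alpha_1,\beta_1))=\mathscr{G}_1(1,j_1,\alpha_1),$$ $$\mathscr{P}_2(\phi(\alpha_1,\beta_1),j_2,\phi(\alpha_2,\beta_2))=\sum_{j=1}^{l}\mathscr{G}_2(\alpha_1,j,\alpha_2)\,\mathscr{H}_1(1,j,\beta_1)\,\mathscr{H}_2(\beta_1,j_2,\beta_2),$$ $$\mathscr{P}_3=\widetilde{\mathscr{P}}_3\times_2\mathbf{F}_{n_3}^{-1}\quad\text{with}\quad\widetilde{\mathscr{P}}_3(\phi(\alpha_2,\beta_2),j_3,1)=\widetilde{\mathscr{G}}_3(\alpha_2,j_3,1)\,\widetilde{\mathscr{H}}_3(\beta_2,j_3,1),$$ where $\phi(\alpha_t,\beta_t)=\alpha_t+(\beta_t-1)r_t$ for $t=1,2$, $\widetilde{\mathscr{G}}_3=\mathscr{G}_3\times_2\mathbf{F}_{n_3}$, and $\widetilde{\mathscr{H}}_3=\mathscr{H}_3\times_2\mathbf{F}_{n_3}$,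 and with TT-ranks $\{1,r_1s_1,r_2s_2,1\}$.
   Context: A tensor $\mathscr{X}$ of size $m_1\times m_2\times m_3$ is in tensor train (TTD) format with core tensors $\mathscr{C}_t$ of size $\rho_{t-1}\times m_t\times\rho_t$ ($t=1,2,3$, $\rho_0=\rho_3=1$) and TT-ranks $\{1,\rho_1,\rho_2,1\}$ if $\mathscr{X}(j_1,j_2,j_3)=\sum_{\alpha_1=1}^{\rho_1}\sum_{\alpha_2=1}^{\rho_2}\mathscr{C}_1(1,j_1,\alpha_1)\mathscr{C}_2(\alpha_1,j_2,\alpha_2)\mathscr{C}_3(\alpha_2,j_3,1)$. Mode-$2$ multiplication: $(\mathscr{G}\times_2\mathbf{A})(a,i,b)=\sum_j\mathbf{A}(i,j)\mathscr{G}(a,j,b)$. $\mathbf{F}_{n}\in\mathbb{C}^{n\times n}$ is the discrete Fourier transform matrix $\mathbf{F}_n(p,q)=\frac{1}{\sqrt{n}}\,\omega^{(p-1)(q-1)}$, $\omega=\exp(-2\pi i/n)$. T-product: $\mathscr{T}\star\mathscr{S}=\texttt{fold}(\texttt{bcirc}(\mathscr{T})\,\texttt{unfold}(\mathscr{S}))$, where $\texttt{bcirc}(\mathscr{T})$ is the $n_3\times n_3$ block matrix with $(p,q)$ block $\mathscr{T}(:,:,((p-q)\bmod n_3)+1)$, $\texttt{unfold}(\mathscr{S})$ stacks the frontal slices $\mathscr{S}(:,:,1),\dots,\mathscr{S}(:,:,n_3)$ vertically, and $\texttt{fold}$ is the inverse of $\texttt{unfold}$.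
   Formalization: The third core is P_3 = sqrt(n_3) times (tilde P_3 x_2 F^{-1}); with the unitary DFT as defined, the displayed formula without the factor sqrt(n_3) represents T*S divided by sqrt(n_3), so it fails for n_3 >= 2. *)

theory Defs
  imports Complex_Main "Jordan_Normal_Form.Gauss_Jordan_Elimination"
begin

(* A third-order tensor is its entry function.  Sizes are passed explicitly and entries outside
   them are irrelevant.  As for matrices in Jordan_Normal_Form, every index is 0-based: entry
   (a, b, c) here is the entry (a+1, b+1, c+1) of the usual 1-based notation. *)
type_synonym 'a tensor3 = "nat \<Rightarrow> nat \<Rightarrow> nat \<Rightarrow> 'a"

definition complex_tensor :: "real tensor3 \<Rightarrow> complex tensor3" where
  "complex_tensor X = (\<lambda>a b c. complex_of_real (X a b c))"

(* is_ttd m1 m2 m3 rho1 rho2 X C1 C2 C3: the tensor X of size m1 x m2 x m3 is in tensor train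
   format with TT-ranks {1, rho1, rho2, 1} and core tensors C1 of size 1 x m1 x rho1,
   C2 of size rho1 x m2 x rho2, C3 of size rho2 x m3 x 1. *)
definition is_ttd ::
  "nat \<Rightarrow> nat \<Rightarrow> nat \<Rightarrow> nat \<Rightarrow> nat \<Rightarrow> ('a::comm_semiring_1) tensor3
    \<Rightarrow> 'a tensor3 \<Rightarrow> 'a tensor3 \<Rightarrow> 'a tensor3 \<Rightarrow> bool" where
  "is_ttd m1 m2 m3 \<rho>1 \<rho>2 X C1 C2 C3 \<longleftrightarrow>
    (\<forall>j1<m1. \<forall>j2<m2. \<forall>j3<m3.
      X j1 j2 j3 = (\<Sum>\<alpha>1<\<rho>1. \<Sum>\<alpha>2<\<rho>2. C1 0 j1 \<alpha>1 * C2 \<alpha>1 j2 \<alpha>2 * C3 \<alpha>2 j3 0))"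

definition mode2_prod :: "('a::comm_semiring_1) tensor3 \<Rightarrow> 'a mat \<Rightarrow> 'a tensor3"
    (infixl "\<times>\<^sub>2" 70) where
  "G \<times>\<^sub>2 A = (\<lambda>a i b. \<Sum>j<dim_col A. A $$ (i, j) * G a j b)"

definition dft_mat :: "nat \<Rightarrow> complex mat" where
  "dft_mat n = mat n n (\<lambda>(p, q).
     1 / complex_of_real (sqrt (real n)) * exp (- 2 * complex_of_real pi * \<i> / of_nat n) ^ (p * q))"

definition dft_mat_inv :: "nat \<Rightarrow> complex mat" where
  "dft_mat_inv n = the (mat_inverse (dft_mat n))"

(* T has size n1 x l x n3.  Row i lies in block row i div n1, column j in block column j div l,
   and block (p, q) is the frontal slice number (p - q) mod n3. *)
definition bcirc :: "nat \<Rightarrow> nat \<Rightarrow> nat \<Rightarrow> 'a tensor3 \<Rightarrow> 'a mat" where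
  "bcirc n1 l n3 T = mat (n1 * n3) (l * n3) (\<lambda>(i, j).
     T (i mod n1) (j mod l) (nat ((int (i div n1) - int (j div l)) mod int n3)))"

(* S has size l x n2 x n3. *)
definition unfold_tensor :: "nat \<Rightarrow> nat \<Rightarrow> nat \<Rightarrow> 'a tensor3 \<Rightarrow> 'a mat" where
  "unfold_tensor l n2 n3 S = mat (l * n3) n2 (\<lambda>(i, j). S (i mod l) j (i div l))"

(* Inverse of unfold_tensor: M has n1 * n3 rows, and block row k is the k-th frontal slice. *)
definition fold_tensor :: "nat \<Rightarrow> 'a mat \<Rightarrow> 'a tensor3" where
  "fold_tensor n1 M = (\<lambda>i j k. M $$ (k * n1 + i, j))"

definition t_product ::
  "nat \<Rightarrow> nat \<Rightarrow> nat \<Rightarrow> nat \<Rightarrow> ('a::semiring_0) tensor3 \<Rightarrow> 'a tensor3 \<Rightarrow> 'a tensor3" where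
  "t_product n1 l n2 n3 T S = fold_tensor n1 (bcirc n1 l n3 T * unfold_tensor l n2 n3 S)"

(* The combined rank index alpha + (beta - 1) r, in 0-based form. *)
definition phi :: "nat \<Rightarrow> nat \<Rightarrow> nat \<Rightarrow> nat" where
  "phi r \<alpha> \<beta> = \<alpha> + \<beta> * r"

(* dft_mat is the unitary DFT, for which the convolution theorem reads
     F (g conv h) = sqrt n * (F g .* F h).
   A core built as (F g .* F h) followed by the inverse of F therefore has to be multiplied by
   sqrt n in order to represent a T-product, whose bcirc carries no normalisation.  With the
   unnormalised DFT matrix sqrt n * F in place of F this factor would not appear. *)

end

theory Submission
  imports Defs "Jordan_Normal_Form.Determinant"
begin

text \<open>
  Writing out the block circulant matrix, entry \<open>(i, j, k)\<close> of the T-product is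
  \<open>\<Sum>q<n3. \<Sum>p<l. T i p ((k - q) mod n3) * S p j q\<close>: a matrix product in the first two modes and a
  cyclic convolution in the third.  Substituting the two tensor trains separates the three modes.
  The first core of \<open>S\<close> has the same spatial index \<open>p\<close> as the second core of \<open>T\<close>, so summing over
  \<open>p\<close> merges them with the second core of \<open>S\<close> into \<open>P2\<close>; and the index \<open>q\<close> meets only the two third
  cores, whose fibres are therefore cyclically convolved.  Pairs of rank indices are merged by
  \<open>phi\<close>, which enumerates \<open>{..<r} \<times> {..<s}\<close> as \<open>{..<r * s}\<close>.

  So a real third core exists in the time domain, namely the convolution of fibres.  That it is the
  core computed in the Fourier domain is the convolution theorem: the discrete Fourier transform
  turns convolution into a pointwise product (\<open>sum_power_cyclic_conv\<close>).  As the transform is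
  unitary, each of the two factors of the product brings \<open>1 / sqrt n3\<close> but the transform of the
  convolution brings only one, which is the origin of the factor \<open>sqrt n3\<close>.  Finally the inverse
  transform applies because powers of a primitive root of unity are orthogonal.
\<close>

section \<open>Pairs of indices\<close>

lemma phi_mod_div:
  assumes "\<alpha> < r"
  shows "phi r \<alpha> \<beta> mod r = \<alpha>" "phi r \<alpha> \<beta> div r = \<beta>"
  using assms by (auto simp: phi_def)

lemma phi_less:
  assumes "\<alpha> < r" "\<beta> < s"
  shows "phi r \<alpha> \<beta> < r * s"
proof -
  have "\<alpha> + \<beta> * r < Suc \<beta> * r" using assms by simp
  also have "\<dots> \<le> s * r" using assms by (intro mult_right_mono) auto
  finally show ?thesis by (simp add: phi_def mult.commute)
qed

lemma sum_phi:
  "(\<Sum>\<gamma><r * s. f \<gamma>) = (\<Sum>\<alpha><r. \<Sum>\<beta><s. f (phi r \<alpha> \<beta>))"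
proof -
  have "(\<Sum>\<gamma><r * s. f \<gamma>) = (\<Sum>(\<alpha>, \<beta>)\<in>{..<r} \<times> {..<s}. f (phi r \<alpha> \<beta>))"
  proof (rule sum.reindex_bij_witness[of _ "\<lambda>(\<alpha>, \<beta>). phi r \<alpha> \<beta>" "\<lambda>\<gamma>. (\<gamma> mod r, \<gamma> div r)"])
    fix \<gamma> assume "\<gamma> \<in> {..<r * s}"
    then have "\<gamma> < r * s" by simp
    moreover from this have "r > 0" by (cases r) auto
    ultimately show "(\<gamma> mod r, \<gamma> div r) \<in> {..<r} \<times> {..<s}"
      by (simp add: less_mult_imp_div_less mult.commute)
  qed (auto simp: phi_mod_div phi_less, auto simp: phi_def)
  then show ?thesis by (simp add: sum.cartesian_product)
qed

section \<open>The cyclic convolution and its transform\<close>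

definition cyclic_conv :: "nat \<Rightarrow> (nat \<Rightarrow> 'a::semiring_0) \<Rightarrow> (nat \<Rightarrow> 'a) \<Rightarrow> nat \<Rightarrow> 'a" where
  "cyclic_conv n g h k = (\<Sum>q<n. g (nat ((int k - int q) mod int n)) * h q)"

lemma complex_of_real_cyclic_conv:
  "complex_of_real (cyclic_conv n g h k)
    = cyclic_conv n (\<lambda>j. complex_of_real (g j)) (\<lambda>j. complex_of_real (h j)) k"
  by (simp add: cyclic_conv_def)

text \<open>A cyclic shift of the summation index multiplies the sum by a power of \<open>z\<close>, because an
  exponent of an \<open>n\<close>-th root of unity matters only modulo \<open>n\<close>.\<close>

lemma sum_power_cyclic_shift:
  fixes z :: "'a::comm_ring_1"
  assumes "z ^ n = 1" "q < n"
  shows "(\<Sum>k<n. z ^ k * g (nat ((int k - int q) mod int n))) = z ^ q * (\<Sum>m<n. z ^ m * g m)"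
proof -
  have pow_mod: "z ^ (k mod n) = z ^ k" for k
    by (subst (2) mult_div_mod_eq[of n k, symmetric]) (simp only: power_add power_mult assms, simp)
  have "(\<Sum>k<n. z ^ k * g (nat ((int k - int q) mod int n)))
      = (\<Sum>m<n. z ^ ((m + q) mod n) * g m)"
  proof (rule sum.reindex_bij_witness[of _ "\<lambda>m. (m + q) mod n" "\<lambda>k. nat ((int k - int q) mod int n)"])
    fix k assume "k \<in> {..<n}"
    then have "k < n" by simp
    have "(nat ((int k - int q) mod int n) + q) mod n = nat (((int k - int q) mod int n + int q) mod int n)"
      using assms(2) by (simp add: nat_mod_distrib nat_add_distrib)
    also have "\<dots> = k" using \<open>k < n\<close> by (simp add: mod_add_left_eq)
    finally show *: "(nat ((int k - int q) mod int n) + q) mod n = k" .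
    show "nat ((int k - int q) mod int n) \<in> {..<n}" using assms(2) by (simp add: nat_less_iff)
    show "z ^ ((nat ((int k - int q) mod int n) + q) mod n) * g (nat ((int k - int q) mod int n))
      = z ^ k * g (nat ((int k - int q) mod int n))" by (simp only: *)
  next
    fix m assume "m \<in> {..<n}"
    then show "nat ((int ((m + q) mod n) - int q) mod int n) = m"
      by (simp add: zmod_int mod_diff_left_eq)
    show "(m + q) mod n \<in> {..<n}" using assms(2) by simp
  qed
  also have "\<dots> = z ^ q * (\<Sum>m<n. z ^ m * g m)"
    by (simp add: pow_mod power_add sum_distrib_left mult_ac)
  finally show ?thesis .
qed

text \<open>The convolution theorem, at a single frequency: evaluation at an \<open>n\<close>-th root of unity is a ring
  homomorphism on polynomials modulo \<open>x ^ n - 1\<close>, whose product is the cyclic convolution of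
  coefficients.\<close>

lemma sum_power_cyclic_conv:
  fixes z :: "'a::comm_ring_1"
  assumes "z ^ n = 1"
  shows "(\<Sum>k<n. z ^ k * cyclic_conv n g h k) = (\<Sum>k<n. z ^ k * g k) * (\<Sum>k<n. z ^ k * h k)"
proof -
  have "(\<Sum>k<n. z ^ k * cyclic_conv n g h k)
      = (\<Sum>q<n. (\<Sum>k<n. z ^ k * g (nat ((int k - int q) mod int n))) * h q)"
    unfolding cyclic_conv_def sum_distrib_left sum_distrib_right mult.assoc by (rule sum.swap)
  also have "\<dots> = (\<Sum>q<n. z ^ q * (\<Sum>m<n. z ^ m * g m) * h q)"
    by (simp add: sum_power_cyclic_shift assms)
  also have "\<dots> = (\<Sum>k<n. z ^ k * g k) * (\<Sum>k<n. z ^ k * h k)"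
    unfolding sum_distrib_left[of "\<Sum>k<n. z ^ k * g k"] by (intro sum.cong) (auto simp: mult_ac)
  finally show ?thesis .
qed

section \<open>The discrete Fourier transform\<close>

definition dft_root :: "nat \<Rightarrow> complex" where
  "dft_root n = exp (- 2 * complex_of_real pi * \<i> / of_nat n)"

lemma dft_mat_carrier: "dft_mat n \<in> carrier_mat n n"
  by (simp add: dft_mat_def)

lemma dft_mat_index:
  assumes "p < n" "q < n"
  shows "dft_mat n $$ (p, q) = 1 / complex_of_real (sqrt (real n)) * (dft_root n ^ p) ^ q"
  using assms by (simp add: dft_mat_def dft_root_def power_mult)

lemma dft_root_power: "dft_root n ^ k = inverse (cis (2 * pi * real k / real n))"
proof -
  have "dft_root n ^ k = exp (of_nat k * (- 2 * complex_of_real pi * \<i> / of_nat n))"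
    unfolding dft_root_def by (rule exp_of_nat_mult[symmetric])
  also have "\<dots> = cis (- (2 * pi * real k / real n))"
    by (simp add: cis_conv_exp mult_ac)
  finally show ?thesis by (simp add: cis_inverse)
qed

lemma dft_root_power_eq_1:
  assumes "n > 0"
  shows "dft_root n ^ n = 1"
  using assms by (simp add: dft_root_power)

lemma dft_root_primitive:
  assumes "p < n" "q < n" "dft_root n ^ p = dft_root n ^ q"
  shows "p = q"
proof -
  have "inj_on (\<lambda>k. cis (2 * pi * real k / real n)) {..<n}"
    using bij_betw_roots_unity[of n] assms by (auto simp: bij_betw_def)
  then show ?thesis using assms by (auto simp: dft_root_power simp del: cis_inverse dest: inj_onD)
qed

text \<open>The inverse is the matrix of inverse powers: off the diagonal, an entry of the product is a
  full geometric sum over a root of unity different from \<open>1\<close>, which vanishes.\<close>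

lemma dft_mat_invertible:
  assumes "n > 0"
  shows "\<exists>B\<in>carrier_mat n n. dft_mat n * B = 1\<^sub>m n"
proof
  let ?w = "dft_root n" and ?s = "complex_of_real (sqrt (real n))"
  let ?B = "mat n n (\<lambda>(p, q). 1 / ?s * inverse (?w ^ q) ^ p)"
  show "?B \<in> carrier_mat n n" by simp
  have w0: "?w \<noteq> 0" by (simp add: dft_root_def)
  have s: "?s * ?s = of_nat n" by (simp flip: of_real_mult)
  show "dft_mat n * ?B = 1\<^sub>m n"
  proof (rule eq_matI)
    fix p q assume "p < dim_row (1\<^sub>m n)" "q < dim_col (1\<^sub>m n)"
    then have pq: "p < n" "q < n" by auto
    let ?x = "?w ^ p * inverse (?w ^ q)"
    have "(dft_mat n * ?B) $$ (p, q) = (\<Sum>k<n. dft_mat n $$ (p, k) * ?B $$ (k, q))"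
      using pq dft_mat_carrier[of n]
      by (simp add: scalar_prod_def lessThan_atLeast0)
    also have "\<dots> = (\<Sum>k<n. 1 / of_nat n * ?x ^ k)"
      using pq by (intro sum.cong) (auto simp: dft_mat_index power_mult_distrib simp flip: s)
    also have "\<dots> = 1 / of_nat n * (\<Sum>k<n. ?x ^ k)" by (simp only: sum_distrib_left)
    also have "\<dots> = 1\<^sub>m n $$ (p, q)"
    proof (cases "p = q")
      case True
      then show ?thesis using w0 pq by simp
    next
      case False
      then have "?x \<noteq> 1"
        using dft_root_primitive[OF pq] w0 by (auto simp: field_simps)
      moreover have "?x ^ n = 1"
      proof -
        have "(?w ^ k) ^ n = 1" for k
          by (metis dft_root_power_eq_1[OF assms] power_commutes power_mult mult.commute power_one)
        then show ?thesis by (simp add: power_mult_distrib power_inverse)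
      qed
      ultimately show ?thesis using False pq by (simp add: geometric_sum)
    qed
    finally show "(dft_mat n * ?B) $$ (p, q) = 1\<^sub>m n $$ (p, q)" .
  qed (simp_all add: dft_mat_def)
qed

lemma dft_mat_inv:
  assumes "n > 0"
  shows "dft_mat_inv n \<in> carrier_mat n n" "dft_mat_inv n * dft_mat n = 1\<^sub>m n"
proof -
  obtain B where B: "B \<in> carrier_mat n n" "dft_mat n * B = 1\<^sub>m n"
    using dft_mat_invertible[OF assms] by blast
  have "B * dft_mat n = 1\<^sub>m n"
    by (rule mat_mult_left_right_inverse[OF dft_mat_carrier B])
  then have "dft_mat n \<in> Units (ring_mat TYPE(complex) n ())"
    using B dft_mat_carrier[of n] by (auto simp: Units_def ring_mat_def)
  then obtain C where C: "mat_inverse (dft_mat n) = Some C"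
    using mat_inverse(1)[OF dft_mat_carrier, of n "()"] by (cases "mat_inverse (dft_mat n)") auto
  show "dft_mat_inv n \<in> carrier_mat n n" "dft_mat_inv n * dft_mat n = 1\<^sub>m n"
    using mat_inverse(2)[OF dft_mat_carrier C] C by (simp_all add: dft_mat_inv_def)
qed

lemma mode2_prod_dft_mat:
  assumes "p < n"
  shows "(X \<times>\<^sub>2 dft_mat n) a p b
    = 1 / complex_of_real (sqrt (real n)) * (\<Sum>k<n. (dft_root n ^ p) ^ k * X a k b)"
  using assms dft_mat_carrier[of n]
  by (simp add: mode2_prod_def dft_mat_index sum_divide_distrib)

lemma mode2_prod_dft_mat_inv:
  assumes "k < n" and Y: "\<And>p. p < n \<Longrightarrow> Y a p b = c * (X \<times>\<^sub>2 dft_mat n) a p b"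
  shows "(Y \<times>\<^sub>2 dft_mat_inv n) a k b = c * X a k b"
proof -
  have n: "n > 0" using assms by simp
  note inv = dft_mat_inv[OF n]
  let ?I = "dft_mat_inv n" and ?F = "dft_mat n"
  have "(Y \<times>\<^sub>2 ?I) a k b = (\<Sum>p<n. ?I $$ (k, p) * (c * (\<Sum>j<n. ?F $$ (p, j) * X a j b)))"
    using inv Y dft_mat_carrier[of n] by (simp add: mode2_prod_def)
  also have "\<dots> = (\<Sum>j<n. (\<Sum>p<n. ?I $$ (k, p) * ?F $$ (p, j)) * (c * X a j b))"
    unfolding sum_distrib_left sum_distrib_right
    by (subst sum.swap) (simp only: mult_ac)
  also have "\<dots> = (\<Sum>j<n. (?I * ?F) $$ (k, j) * (c * X a j b))"
    using inv(1) dft_mat_carrier[of n] assms(1)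
    by (intro sum.cong) (auto simp: scalar_prod_def lessThan_atLeast0)
  also have "\<dots> = (\<Sum>j<n. if k = j then c * X a j b else 0)"
    using assms(1) by (intro sum.cong) (auto simp: inv(2))
  also have "\<dots> = c * X a k b" using assms(1) by simp
  finally show ?thesis .
qed

text \<open>The source of the factor \<open>sqrt n\<close>: the pointwise product of two unitary transforms carries the
  square of \<open>1 / sqrt n\<close>, the transform of the convolution carries it once.\<close>

lemma dft_mat_cyclic_conv:
  assumes "p < n"
    and "\<And>k. k < n \<Longrightarrow> Z c k b = cyclic_conv n (\<lambda>j. X a j b) (\<lambda>j. Y a' j b) k"
  shows "(X \<times>\<^sub>2 dft_mat n) a p b * (Y \<times>\<^sub>2 dft_mat n) a' p b
    = 1 / complex_of_real (sqrt (real n)) * (Z \<times>\<^sub>2 dft_mat n) c p b"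
proof -
  have "(dft_root n ^ p) ^ n = 1"
    using dft_root_power_eq_1[of n] assms(1)
    by (metis gr_implies_not0 mult.commute neq0_conv power_mult power_one)
  from sum_power_cyclic_conv[OF this, of "\<lambda>j. X a j b" "\<lambda>j. Y a' j b"] show ?thesis
    by (simp add: mode2_prod_dft_mat[OF assms(1)] assms(2))
qed

section \<open>The T-product of two tensor trains\<close>

lemma t_product_entry:
  fixes T S :: "'a::semiring_0 tensor3"
  assumes "i < n1" "j < n2" "k < n3"
  shows "t_product n1 l n2 n3 T S i j k
    = (\<Sum>p<l. cyclic_conv n3 (\<lambda>m. T i p m) (\<lambda>q. S p j q) k)"
proof -
  have row: "k * n1 + i < n1 * n3"
    using phi_less[OF assms(1,3)] by (simp add: phi_def add.commute)
  have "t_product n1 l n2 n3 T S i j k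
      = (\<Sum>c<l * n3. T i (c mod l) (nat ((int k - int (c div l)) mod int n3)) * S (c mod l) j (c div l))"
    using row assms
    by (simp add: t_product_def fold_tensor_def bcirc_def unfold_tensor_def scalar_prod_def
        lessThan_atLeast0)
  also have "\<dots> = (\<Sum>p<l. \<Sum>q<n3. T i p (nat ((int k - int q) mod int n3)) * S p j q)"
    unfolding sum_phi by (simp add: phi_mod_div)
  finally show ?thesis by (simp add: cyclic_conv_def)
qed

lemma cyclic_conv_sum:
  fixes c d :: "_ \<Rightarrow> 'a::comm_semiring_1"
  shows "cyclic_conv n (\<lambda>m. \<Sum>x\<in>A. c x * g x m) (\<lambda>q. \<Sum>y\<in>B. d y * h y q) k
    = (\<Sum>x\<in>A. \<Sum>y\<in>B. c x * d y * cyclic_conv n (g x) (h y) k)"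
proof -
  have "cyclic_conv n (\<lambda>m. \<Sum>x\<in>A. c x * g x m) (\<lambda>q. \<Sum>y\<in>B. d y * h y q) k
     = (\<Sum>q<n. \<Sum>x\<in>A. \<Sum>y\<in>B. c x * d y * (g x (nat ((int k - int q) mod int n)) * h y q))"
    unfolding cyclic_conv_def sum_product by (simp only: mult_ac)
  also have "\<dots> = (\<Sum>x\<in>A. \<Sum>y\<in>B. \<Sum>q<n. c x * d y * (g x (nat ((int k - int q) mod int n)) * h y q))"
    by (subst sum.swap) (intro sum.cong refl sum.swap)
  finally show ?thesis by (simp add: cyclic_conv_def sum_distrib_left)
qed

text \<open>The representation itself, over any commutative semiring and without Fourier transforms.
  Convolution is bilinear, so it passes through the sums over the rank indices and only the third
  cores are convolved.\<close>

lemma is_ttd_t_product: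
  fixes T S :: "'a::comm_semiring_1 tensor3"
  assumes T: "is_ttd n1 l n3 r1 r2 T G1 G2 G3" and S: "is_ttd l n2 n3 s1 s2 S H1 H2 H3"
    and P1: "\<And>j \<alpha> \<beta>. j < n1 \<Longrightarrow> \<alpha> < r1 \<Longrightarrow> \<beta> < s1 \<Longrightarrow> P1 0 j (phi r1 \<alpha> \<beta>) = G1 0 j \<alpha>"
    and P2: "\<And>\<alpha> \<beta> j \<alpha>' \<beta>'. \<alpha> < r1 \<Longrightarrow> \<beta> < s1 \<Longrightarrow> j < n2 \<Longrightarrow> \<alpha>' < r2 \<Longrightarrow> \<beta>' < s2 \<Longrightarrow>
      P2 (phi r1 \<alpha> \<beta>) j (phi r2 \<alpha>' \<beta>') = (\<Sum>p<l. G2 \<alpha> p \<alpha>' * H1 0 p \<beta> * H2 \<beta> j \<beta>')"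
    and P3: "\<And>\<alpha> \<beta> k. \<alpha> < r2 \<Longrightarrow> \<beta> < s2 \<Longrightarrow> k < n3 \<Longrightarrow>
      P3 (phi r2 \<alpha> \<beta>) k 0 = cyclic_conv n3 (\<lambda>m. G3 \<alpha> m 0) (\<lambda>q. H3 \<beta> q 0) k"
  shows "is_ttd n1 n2 n3 (r1 * s1) (r2 * s2) (t_product n1 l n2 n3 T S) P1 P2 P3"
  unfolding is_ttd_def
proof (intro allI impI)
  fix i j k assume ijk: "i < n1" "j < n2" "k < n3"
  let ?conv = "\<lambda>\<alpha> \<beta>. cyclic_conv n3 (\<lambda>m. G3 \<alpha> m 0) (\<lambda>q. H3 \<beta> q 0) k"
  let ?term = "\<lambda>p x y. G1 0 i (fst x) * (G2 (fst x) p (snd x) * H1 0 p (fst y) * H2 (fst y) j (snd y))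
    * ?conv (snd x) (snd y)"
  have T_pairs: "T i p m = (\<Sum>x\<in>{..<r1} \<times> {..<r2}. (G1 0 i (fst x) * G2 (fst x) p (snd x)) * G3 (snd x) m 0)"
    if "p < l" "m < n3" for p m
    using T ijk(1) that by (simp add: is_ttd_def sum.cartesian_product case_prod_unfold)
  have S_pairs: "S p j q = (\<Sum>y\<in>{..<s1} \<times> {..<s2}. (H1 0 p (fst y) * H2 (fst y) j (snd y)) * H3 (snd y) q 0)"
    if "p < l" "q < n3" for p q
    using S ijk(2) that by (simp add: is_ttd_def sum.cartesian_product case_prod_unfold)
  have "t_product n1 l n2 n3 T S i j k
      = (\<Sum>p<l. cyclic_conv n3 (\<lambda>m. T i p m) (\<lambda>q. S p j q) k)"
    by (rule t_product_entry[OF ijk])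
  also have "\<dots> = (\<Sum>p<l. cyclic_conv n3
        (\<lambda>m. \<Sum>x\<in>{..<r1} \<times> {..<r2}. (G1 0 i (fst x) * G2 (fst x) p (snd x)) * G3 (snd x) m 0)
        (\<lambda>q. \<Sum>y\<in>{..<s1} \<times> {..<s2}. (H1 0 p (fst y) * H2 (fst y) j (snd y)) * H3 (snd y) q 0) k)"
  proof (intro sum.cong refl)
    fix p assume p: "p \<in> {..<l}"
    have "nat ((int k - int q) mod int n3) < n3" for q using ijk(3) by (simp add: nat_less_iff)
    then show "cyclic_conv n3 (\<lambda>m. T i p m) (\<lambda>q. S p j q) k = cyclic_conv n3
        (\<lambda>m. \<Sum>x\<in>{..<r1} \<times> {..<r2}. (G1 0 i (fst x) * G2 (fst x) p (snd x)) * G3 (snd x) m 0)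
        (\<lambda>q. \<Sum>y\<in>{..<s1} \<times> {..<s2}. (H1 0 p (fst y) * H2 (fst y) j (snd y)) * H3 (snd y) q 0) k"
      unfolding cyclic_conv_def using p by (intro sum.cong refl arg_cong2[of _ _ _ _ "(*)"] T_pairs S_pairs) auto
  qed
  also have "\<dots> = (\<Sum>p<l. \<Sum>x\<in>{..<r1} \<times> {..<r2}. \<Sum>y\<in>{..<s1} \<times> {..<s2}. ?term p x y)"
    unfolding cyclic_conv_sum by (simp only: mult_ac)
  also have "\<dots> = (\<Sum>x\<in>{..<r1} \<times> {..<r2}. \<Sum>y\<in>{..<s1} \<times> {..<s2}. \<Sum>p<l. ?term p x y)"
    by (subst sum.swap) (intro sum.cong[OF refl] sum.swap)
  also have "\<dots> = (\<Sum>\<alpha><r1. \<Sum>\<alpha>'<r2. \<Sum>\<beta><s1. \<Sum>\<beta>'<s2. \<Sum>p<l. ?term p (\<alpha>, \<alpha>') (\<beta>, \<beta>'))"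
    by (simp only: sum.cartesian_product' fst_conv snd_conv)
  also have "\<dots> = (\<Sum>\<alpha><r1. \<Sum>\<beta><s1. \<Sum>\<alpha>'<r2. \<Sum>\<beta>'<s2. \<Sum>p<l. ?term p (\<alpha>, \<alpha>') (\<beta>, \<beta>'))"
    by (rule sum.cong[OF refl], rule sum.swap)
  also have "\<dots> = (\<Sum>\<alpha><r1. \<Sum>\<beta><s1. \<Sum>\<alpha>'<r2. \<Sum>\<beta>'<s2.
        P1 0 i (phi r1 \<alpha> \<beta>) * P2 (phi r1 \<alpha> \<beta>) j (phi r2 \<alpha>' \<beta>') * P3 (phi r2 \<alpha>' \<beta>') k 0)"
    using ijk by (simp add: P1 P2 P3 sum_distrib_left sum_distrib_right)
  also have "\<dots> = (\<Sum>\<gamma><r1 * s1. \<Sum>\<delta><r2 * s2. P1 0 i \<gamma> * P2 \<gamma> j \<delta> * P3 \<delta> k 0)"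
    by (simp add: sum_phi)
  finally show "t_product n1 l n2 n3 T S i j k
      = (\<Sum>\<gamma><r1 * s1. \<Sum>\<delta><r2 * s2. P1 0 i \<gamma> * P2 \<gamma> j \<delta> * P3 \<delta> k 0)" .
qed

theorem proposition3p5:
  fixes n1 n2 n3 l r1 r2 s1 s2 :: nat
    and T S G1 G2 G3 H1 H2 H3 :: "real tensor3"
  assumes "is_ttd n1 l n3 r1 r2 T G1 G2 G3"
    and "is_ttd l n2 n3 s1 s2 S H1 H2 H3"
  shows "\<exists>(P1 :: real tensor3) (P2 :: real tensor3) (P3 :: real tensor3) (P3' :: complex tensor3).
      (\<forall>j1<n1. \<forall>\<alpha>1<r1. \<forall>\<beta>1<s1.
         P1 0 j1 (phi r1 \<alpha>1 \<beta>1) = G1 0 j1 \<alpha>1) \<and>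
      (\<forall>\<alpha>1<r1. \<forall>\<beta>1<s1. \<forall>j2<n2. \<forall>\<alpha>2<r2. \<forall>\<beta>2<s2.
         P2 (phi r1 \<alpha>1 \<beta>1) j2 (phi r2 \<alpha>2 \<beta>2)
           = (\<Sum>j<l. G2 \<alpha>1 j \<alpha>2 * H1 0 j \<beta>1 * H2 \<beta>1 j2 \<beta>2)) \<and>
      (\<forall>\<alpha>2<r2. \<forall>\<beta>2<s2. \<forall>j3<n3.
         P3' (phi r2 \<alpha>2 \<beta>2) j3 0
           = (complex_tensor G3 \<times>\<^sub>2 dft_mat n3) \<alpha>2 j3 0
             * (complex_tensor H3 \<times>\<^sub>2 dft_mat n3) \<beta>2 j3 0) \<and>
      (\<forall>\<gamma><r2 * s2. \<forall>j3<n3.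
         complex_tensor P3 \<gamma> j3 0
           = complex_of_real (sqrt (real n3)) * (P3' \<times>\<^sub>2 dft_mat_inv n3) \<gamma> j3 0) \<and>
      is_ttd n1 n2 n3 (r1 * s1) (r2 * s2) (t_product n1 l n2 n3 T S) P1 P2 P3"
proof -
  \<comment> \<open>The rank pair is recovered from its code \<open>\<gamma>\<close> as \<open>(\<gamma> mod r, \<gamma> div r)\<close>.\<close>
  define P1 :: "real tensor3" where "P1 = (\<lambda>a j \<gamma>. G1 a j (\<gamma> mod r1))"
  define P2 :: "real tensor3" where "P2 = (\<lambda>\<gamma> j \<delta>. \<Sum>p<l.
    G2 (\<gamma> mod r1) p (\<delta> mod r2) * H1 0 p (\<gamma> div r1) * H2 (\<gamma> div r1) j (\<delta> div r2))"
  define P3 :: "real tensor3" where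
    "P3 = (\<lambda>\<delta> k c. cyclic_conv n3 (\<lambda>m. G3 (\<delta> mod r2) m c) (\<lambda>q. H3 (\<delta> div r2) q c) k)"
  define P3' :: "complex tensor3" where
    "P3' = (\<lambda>\<delta> k c. (complex_tensor G3 \<times>\<^sub>2 dft_mat n3) (\<delta> mod r2) k c
      * (complex_tensor H3 \<times>\<^sub>2 dft_mat n3) (\<delta> div r2) k c)"
  have "complex_tensor P3 \<gamma> k 0
      = complex_of_real (sqrt (real n3)) * (P3' \<times>\<^sub>2 dft_mat_inv n3) \<gamma> k 0" if k: "k < n3" for \<gamma> k
  proof -
    have "P3' \<gamma> p 0
        = 1 / complex_of_real (sqrt (real n3)) * (complex_tensor P3 \<times>\<^sub>2 dft_mat n3) \<gamma> p 0"
      if "p < n3" for p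
      unfolding P3'_def by (rule dft_mat_cyclic_conv[OF that])
        (simp add: P3_def complex_tensor_def complex_of_real_cyclic_conv)
    from mode2_prod_dft_mat_inv[OF k, of P3' \<gamma> 0, OF this] show ?thesis using k by simp
  qed
  moreover have "is_ttd n1 n2 n3 (r1 * s1) (r2 * s2) (t_product n1 l n2 n3 T S) P1 P2 P3"
    using assms by (rule is_ttd_t_product) (simp_all add: P1_def P2_def P3_def phi_mod_div)
  ultimately show ?thesis
    by (intro exI[of _ P1] exI[of _ P2] exI[of _ P3] exI[of _ P3'])
      (simp add: P1_def P2_def P3'_def phi_mod_div)
qed

end
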